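(* Let $(X,d)$ be a metric space and let $\Phi:X\to\mathbb R\cup\{+\infty\}$ be a proper functional bounded from below. Assume that there exists an upper gradient $g:X\to\mathbb R\cup\{+\infty\}$ of $\Phi$ such that $\mathcal M(g)\neq\emptyset$. Let $u\in\mathcal M(g)$ and $\varepsilon>0$ be such that $$\Phi(u)\le\inf_X\Phi+\varepsilon.$$ Then for any $\lambda>0$ there exists $\hat u\in\mathcal M(g)$ such that (a) $d(u,\hat u)\le\lambda$; (b) $\Phi(\hat u)\le\Phi(u)$; (c) $g(\hat u)\le\varepsilon/\lambda$.
   Context: Notation: $\operatorname{dom}\Phi=\{u\in X:\Phi(u)<+\infty\}$; proper means $\operatorname{dom}\Phi\ne\emptyset$. The metric space is not assumed complete. Locally absolutely continuous curve: a curve $v:(0,+\infty)\to X$ for which there is a nonnegative $m\in L^1_{\mathrm{loc}}(0,+\infty)$ with $d(v(t),v(s))\le\int_s^t m(r)\,dr$ for all $0<s\le t$. For such a curve the metric derivative $|\dot v|(t):=\lim_{h\to0}\frac{d(v(t+h),v(t))}{|h|}$ exists for a.e. $t$ and belongs to $L^1_{\mathrm{loc}}(0,+\infty)$. (Strong) upper gradient of $\Phi$: a nonnegative function $g:X\to\mathbb R\cup\{+\infty\}$ such that for every locally absolutely continuous curve $v:(0,+\infty)\to X$ with values in $\operatorname{dom}\Phi$, the function $g\circ v$ is Borel measurable and $|\Phi(v(t))-\Phi(v(s))|\le\int_s^t g(v(r))\,|\dot v|(r)\,dr$ for all $0<s\le t$ (the right-hand side may be $+\infty$). "Upper gradient"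 always means strong upper gradient. Gradient flow of $\Phi$ with respect to an upper gradient $g$: a locally absolutely continuous curve $v:(0,+\infty)\to X$ such that (1) $v(t)\in\operatorname{dom}\Phi$ for all $t>0$; (2) $\Phi(v(t))-\Phi(v(s))\le-\frac12\int_s^t|\dot v|(r)^2\,dr-\frac12\int_s^t g(v(r))^2\,dr$ for all $s,t\in(0,+\infty)$ (integrals are oriented). $\mathcal M(g)$ is the set of all $u\in\operatorname{dom}\Phi$ for which there exists a gradient flow $v:(0,+\infty)\to X$ of $\Phi$ with respect to $g$ with $\lim_{t\to0^+}v(t)=u$ and $\lim_{t\to0^+}\Phi(v(t))=\Phi(u)$. *)

theory Defs
  imports "HOL-Analysis.Analysis"
begin

text \<open>
  Functionals with values in \<open>\<real> \<union> {+\<infinity>}\<close> are modelled as functions into \<^typ>\<open>ereal\<close> that omit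
  \<open>-\<infinity>\<close>; nonnegative functions into \<open>\<real> \<union> {+\<infinity>}\<close> are functions into \<^typ>\<open>ennreal\<close>.
  A curve \<open>v : (0,+\<infinity>) \<rightarrow> X\<close> is a function on \<^typ>\<open>real\<close> of which only the values at positive
  arguments matter.
\<close>

definition effective_domain :: "('a \<Rightarrow> ereal) \<Rightarrow> 'a set" where
  "effective_domain \<Phi> = {u. \<Phi> u < \<infinity>}"

definition proper_functional :: "('a \<Rightarrow> ereal) \<Rightarrow> bool" where
  "proper_functional \<Phi> \<longleftrightarrow> effective_domain \<Phi> \<noteq> {}"

definition loc_abs_continuous :: "(real \<Rightarrow> 'a::metric_space) \<Rightarrow> bool" where
  "loc_abs_continuous v \<longleftrightarrow>
     (\<exists>m :: real \<Rightarrow> real.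
        (\<forall>r>0. 0 \<le> m r) \<and>
        (\<forall>a b. 0 < a \<and> a \<le> b \<longrightarrow> set_integrable lborel {a..b} m) \<and>
        (\<forall>s t. 0 < s \<and> s \<le> t \<longrightarrow> dist (v t) (v s) \<le> (LINT r:{s..t}|lborel. m r)))"

text \<open>
  Where the limit does not exist, \<^const>\<open>Lim\<close> returns an unspecified number. For locally absolutely
  continuous curves this only concerns a null set of positive times.
\<close>
definition metric_derivative :: "(real \<Rightarrow> 'a::metric_space) \<Rightarrow> real \<Rightarrow> real" where
  "metric_derivative v t = Lim (at 0) (\<lambda>h. dist (v (t + h)) (v t) / \<bar>h\<bar>)"

text \<open>In \<^typ>\<open>ennreal\<close>, \<open>\<infinity> * 0 = 0\<close>, the usual convention for the integrand below.\<close>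
definition upper_gradient :: "('a::metric_space \<Rightarrow> ereal) \<Rightarrow> ('a \<Rightarrow> ennreal) \<Rightarrow> bool" where
  "upper_gradient \<Phi> g \<longleftrightarrow>
     (\<forall>v. loc_abs_continuous v \<and> (\<forall>t>0. v t \<in> effective_domain \<Phi>) \<longrightarrow>
        (\<lambda>r. g (v r)) \<in> borel_measurable (restrict_space borel {0<..}) \<and>
        (\<forall>s t. 0 < s \<and> s \<le> t \<longrightarrow>
           \<bar>\<Phi> (v t) - \<Phi> (v s)\<bar> \<le>
             enn2ereal (\<integral>\<^sup>+ r\<in>{s..t}. g (v r) * ennreal (metric_derivative v r) \<partial>lborel)))"

definition oriented_integral :: "real \<Rightarrow> real \<Rightarrow> (real \<Rightarrow> ennreal) \<Rightarrow> ereal" where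
  "oriented_integral s t f =
     (if s \<le> t then enn2ereal (\<integral>\<^sup>+ r\<in>{s..t}. f r \<partial>lborel)
      else - enn2ereal (\<integral>\<^sup>+ r\<in>{t..s}. f r \<partial>lborel))"

text \<open>
  The energy inequality is required for both orders of \<open>s\<close> and \<open>t\<close>. The two integrals always have
  the same sign, so the right-hand side never has the form \<open>\<infinity> - \<infinity>\<close>.
\<close>
definition gradient_flow ::
  "('a::metric_space \<Rightarrow> ereal) \<Rightarrow> ('a \<Rightarrow> ennreal) \<Rightarrow> (real \<Rightarrow> 'a) \<Rightarrow> bool" where
  "gradient_flow \<Phi> g v \<longleftrightarrow>
     loc_abs_continuous v \<and>
     (\<forall>t>0. v t \<in> effective_domain \<Phi>) \<and>
     (\<forall>s>0. \<forall>t>0.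
        \<Phi> (v t) - \<Phi> (v s) \<le>
          - (ereal (1/2) * oriented_integral s t (\<lambda>r. (ennreal (metric_derivative v r))\<^sup>2))
          - ereal (1/2) * oriented_integral s t (\<lambda>r. (g (v r))\<^sup>2))"

definition flow_starting_points ::
  "('a::metric_space \<Rightarrow> ereal) \<Rightarrow> ('a \<Rightarrow> ennreal) \<Rightarrow> 'a set" where
  "flow_starting_points \<Phi> g =
     {u \<in> effective_domain \<Phi>.
        \<exists>v. gradient_flow \<Phi> g v \<and>
            (v \<longlongrightarrow> u) (at_right 0) \<and>
            ((\<lambda>t. \<Phi> (v t)) \<longlongrightarrow> \<Phi> u) (at_right 0)}"

end

theory Submission
  imports Defs
begin

text \<open>
  Follow the gradient flow \<open>v\<close> that starts at \<open>u\<close>. Each point \<open>v t\<close> with \<open>t > 0\<close> is again a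
  starting point, so it suffices to find \<open>t > 0\<close> with \<open>dist u (v t) \<le> lam\<close> and \<open>g (v t) \<le> c\<close>,
  where \<open>c = \<epsilon> / lam\<close>. Suppose \<open>g (v t) > c\<close> whenever \<open>dist u (v t) \<le> lam\<close>. If the flow never
  leaves the ball, its dissipation grows at least like \<open>c\<^sup>2 t / 2\<close>, although it is at most \<open>\<epsilon>\<close>.
  Otherwise let \<open>T\<close> be the first time at distance \<open>lam\<close>; by Young's inequality the energy drop up
  to \<open>T\<close> exceeds \<open>c\<close> times the length of the curve, hence exceeds \<open>c * lam = \<epsilon>\<close>, which is absurd.

  The analytic input is that a locally absolutely continuous curve has a metric derivative almost
  everywhere, whose integral bounds the distance. The functions
  \<open>f\<^sub>q t = dist (v t) (v q)\<close>, \<open>q\<close> rational, are indefinite integrals of densities \<open>w\<^sub>q\<close>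
  (Radon--Nikodym); by the Lebesgue differentiation theorem (Henstock's lemma and Vitali covering)
  the metric derivative is \<open>M = (SUP q. \<bar>w\<^sub>q\<bar>)\<close>.
\<close>

section \<open>Lebesgue differentiation on the line\<close>

text \<open>Each interval that witnesses a bad point has a Henstock error above
  \<open>\<kappa>\<close> times its length. Henstock's lemma bounds the total error of a fine
  disjoint family of such intervals, hence its total length, and Vitali's theorem covers almost all
  of the bad set by such a family.\<close>

lemma negligible_bad_points_indefinite_integral:
  fixes f W :: "real \<Rightarrow> real" and \<kappa> :: real
  assumes f: "f integrable_on {a..b}"
    and W: "\<And>s t. a \<le> s \<Longrightarrow> s \<le> t \<Longrightarrow> t \<le> b \<Longrightarrow> W t - W s = integral {s..t} f"
    and \<kappa>: "\<kappa> > 0"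
  shows "negligible {x \<in> {a<..<b}. \<forall>d>0. \<exists>s t. s \<le> x \<and> x \<le> t \<and> s < t \<and> t - s < d \<and>
                       \<kappa> * (t - s) < \<bar>W t - W s - (t - s) * f x\<bar>}" (is "negligible ?E")
proof -
  define E where "E = ?E"
  have "\<exists>T. E \<subseteq> T \<and> T \<in> lmeasurable \<and> measure lebesgue T \<le> e" if "e > 0" for e :: real
  proof -
    have f': "f integrable_on cbox a b" using f by simp
    \<comment> \<open>The error is divided by \<open>\<kappa>\<close> later, so this tolerance
      yields total length at most \<open>e\<close>.\<close>
    have "e * \<kappa> > 0" using \<open>e > 0\<close> \<kappa> by simp
    then obtain \<gamma> where \<gamma>: "gauge \<gamma>" and hen: "\<And>p. \<lbrakk>p tagged_partial_division_of (cbox a b); \<gamma> fine p\<rbrakk> \<Longrightarrow>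
               sum (\<lambda>(x,k). norm (measure lborel k *\<^sub>R f x - integral k f)) p < e * \<kappa>"
      by (rule Henstock_lemma[OF f']) blast
    \<comment> \<open>The tag \<open>x\<close> is kept beside the endpoints: the Henstock sum
      evaluates \<open>f\<close> there, and it need not be the midpoint. Containment in
      \<open>\<gamma> x\<close> makes finite subfamilies fine.\<close>
    define I where "I = {(x, s, t). x \<in> E \<and> s \<le> x \<and> x \<le> t \<and> s < t \<and> {s..t} \<subseteq> \<gamma> x \<inter> {a<..<b} \<and>
                         \<kappa> * (t - s) < \<bar>W t - W s - (t - s) * f x\<bar>}"
    define ctr rad where "ctr = (\<lambda>(x::real, s, t). (s + t) / 2 :: real)"
      and "rad = (\<lambda>(x::real, s, t). (t - s) / 2 :: real)"
    have cb: "cball (ctr i) (rad i) = (case i of (x, s, t) \<Rightarrow> {s..t})" for i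
      by (cases i) (simp add: ctr_def rad_def cball_eq_atLeastAtMost field_simps)
    have rpos: "0 < rad i" if "i \<in> I" for i
      using that by (auto simp: I_def rad_def)
    have cover: "\<exists>i. i \<in> I \<and> x \<in> cball (ctr i) (rad i) \<and> rad i < d" if "x \<in> E" "0 < d" for x d
    proof -
      have "open (\<gamma> x \<inter> {a<..<b})" "x \<in> \<gamma> x \<inter> {a<..<b}"
        using \<gamma> that(1) by (auto simp: gauge_def E_def)
      then obtain \<eta> where \<eta>: "\<eta> > 0" "ball x \<eta> \<subseteq> \<gamma> x \<inter> {a<..<b}"
        by (meson open_contains_ball)
      from that(1) have "\<forall>d>0. \<exists>s t. s \<le> x \<and> x \<le> t \<and> s < t \<and> t - s < d \<and>
                         \<kappa> * (t - s) < \<bar>W t - W s - (t - s) * f x\<bar>"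
        unfolding E_def by blast
      moreover have "min d \<eta> > 0" using that(2) \<eta>(1) by simp
      ultimately obtain s t where st: "s \<le> x" "x \<le> t" "s < t" "t - s < min d \<eta>"
        "\<kappa> * (t - s) < \<bar>W t - W s - (t - s) * f x\<bar>" by metis
      have "{s..t} \<subseteq> ball x \<eta>"
        using st by (auto simp: dist_real_def)
      with \<eta> st that have "(x, s, t) \<in> I"
        unfolding I_def by blast
      moreover have "rad (x, s, t) < d"
        using st that(2) by (simp add: rad_def)
      ultimately show ?thesis
        using st by (intro exI[of _ "(x, s, t)"]) (simp add: cb)
    qed
    obtain C where C: "countable C" "C \<subseteq> I"
       "pairwise (\<lambda>i j. disjnt (cball (ctr i) (rad i)) (cball (ctr j) (rad j))) C"
       "negligible (E - (\<Union>i \<in> C. cball (ctr i) (rad i)))"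
      by (rule Vitali_covering_theorem_cballs[of I rad E ctr, OF rpos cover])
    define U where "U = (\<Union>i \<in> C. cball (ctr i) (rad i))"
    have fin: "measure lebesgue (\<Union>i \<in> D. cball (ctr i) (rad i)) \<le> e" if D: "D \<subseteq> C" "finite D" for D
    proof -
      define h where "h = (\<lambda>(x::real, s::real, t). (x, {s..t}))"
      have DI: "D \<subseteq> I" using D C by blast
      \<comment> \<open>Nondegeneracy \<open>s < t\<close> makes the interval determine its
        endpoints; injectivity then turns the sum over triples into the Henstock sum over pairs of
        tag and interval.\<close>
      have inj: "inj_on h D"
        unfolding inj_on_def
      proof (intro ballI impI)
        fix i j assume "i \<in> D" "j \<in> D" "h i = h j"
        moreover obtain x s t x' s' t' where "i = (x, s, t)" "j = (x', s', t')"
          by (cases i, cases j) auto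
        ultimately show "i = j"
          using DI by (auto simp: h_def I_def Icc_eq_Icc)
      qed
      have part: "h ` D tagged_partial_division_of cbox a b"
        unfolding tagged_partial_division_of_def
      proof (intro conjI allI impI)
        show "finite (h ` D)" using D by simp
        fix x K assume "(x, K) \<in> h ` D"
        then obtain s t where xK: "(x, s, t) \<in> D" "K = {s..t}" by (auto simp: h_def)
        with DI have *: "s \<le> x" "x \<le> t" "{s..t} \<subseteq> {a<..<b}" by (auto simp: I_def)
        then show "x \<in> K" using xK by auto
        show "K \<subseteq> cbox a b"
          unfolding xK cbox_interval by (rule subset_trans[OF *(3)]) auto
        show "\<exists>a b. K = cbox a b" using xK by auto
      next
        fix x K x' K' assume h: "(x, K) \<in> h ` D \<and> (x', K') \<in> h ` D \<and> (x, K) \<noteq> (x', K')"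
        then obtain s t s' t' where *: "(x, s, t) \<in> D" "K = {s..t}" "(x', s', t') \<in> D" "K' = {s'..t'}"
          by (auto simp: h_def)
        with h have "(x, s, t) \<noteq> (x', s', t')" by auto
        with * C(3) D(1) have "disjnt (cball (ctr (x, s, t)) (rad (x, s, t))) (cball (ctr (x', s', t')) (rad (x', s', t')))"
          by (meson pairwiseD subsetD)
        then have "disjnt K K'" by (simp add: cb *)
        then show "interior K \<inter> interior K' = {}"
          using interior_subset by (fastforce simp: disjnt_def)
      qed
      have fine: "\<gamma> fine h ` D"
        using DI by (auto simp: fine_def h_def I_def)
      have "measure lebesgue (\<Union>i \<in> D. cball (ctr i) (rad i)) \<le> (\<Sum>i\<in>D. measure lebesgue (cball (ctr i) (rad i)))"
        using D by (intro measure_UNION_le) auto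
      also have "\<dots> = (\<Sum>(x, s, t)\<in>D. t - s)"
        using DI by (intro sum.cong refl) (auto simp: cb I_def)
      also have "\<dots> \<le> (\<Sum>(x, s, t)\<in>D. norm (measure lborel {s..t} *\<^sub>R f x - integral {s..t} f) / \<kappa>)"
      proof (rule sum_mono, clarify)
        fix x s t assume "(x, s, t) \<in> D"
        with DI have *: "s < t" "{s..t} \<subseteq> {a<..<b}" "\<kappa> * (t - s) < \<bar>W t - W s - (t - s) * f x\<bar>"
          by (auto simp: I_def)
        have "s \<in> {s..t}" "t \<in> {s..t}" using *(1) by auto
        with *(2) have ab: "a < s" "t < b" by auto
        have "W t - W s = integral {s..t} f"
          using W[of s t] ab *(1) by simp
        with * show "t - s \<le> norm (measure lborel {s..t} *\<^sub>R f x - integral {s..t} f) / \<kappa>"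
          using \<kappa> by (simp add: field_simps abs_minus_commute)
      qed
      also have "\<dots> = (\<Sum>(x, K)\<in>h ` D. norm (measure lborel K *\<^sub>R f x - integral K f)) / \<kappa>"
        by (subst sum.reindex[OF inj]) (simp add: sum_divide_distrib h_def case_prod_unfold)
      also have "\<dots> \<le> e"
        using hen[OF part fine] \<kappa> by (simp add: field_simps)
      finally show ?thesis .
    qed
    \<comment> \<open>The bound on finite subfamilies passes to the countable union; adding the
      uncovered null set does not increase the measure.\<close>
    have U: "U \<in> lmeasurable" "measure lebesgue U \<le> e"
      unfolding U_def using C(1) fin
      by (intro fmeasurable_UN_bound[of C _ lebesgue e] measure_UN_bound[of C _ lebesgue e]; simp)+
    have N: "negligible (E - U)" using C(4) by (simp add: U_def)
    have "measure lebesgue (U \<union> (E - U)) \<le> e"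
      using measure_Un_le[of U lebesgue "E - U"] negligible_imp_measure0[OF N] negligible_imp_measurable[OF N] U
      by auto
    moreover have "U \<union> (E - U) \<in> lmeasurable"
      using U(1) negligible_imp_measurable[OF N] by (rule fmeasurable.Un)
    ultimately show "\<exists>T. E \<subseteq> T \<and> T \<in> lmeasurable \<and> measure lebesgue T \<le> e"
      by (intro exI[of _ "U \<union> (E - U)"]) auto
qed
  then show ?thesis
    unfolding negligible_outer_le E_def by blast
qed

text \<open>The exceptional set is a countable union of null sets, indexed by windows
  \<open>(-n, n)\<close> and tolerances \<open>1 / (k + 1)\<close>. Elsewhere, intervals with
  \<open>x\<close> as an endpoint give the estimate for difference quotients on either side.\<close>

proposition AE_has_derivative_indefinite_integral:
  fixes f W :: "real \<Rightarrow> real"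
  assumes f: "integrable lborel f"
    and W: "\<And>s t. s \<le> t \<Longrightarrow> W t - W s = (LINT y:{s..t}|lborel. f y)"
  shows "AE x in lborel. (W has_real_derivative f x) (at x)"
proof -
  define E where "E n k = {x \<in> {- real n<..<real n}. \<forall>d>0. \<exists>s t. s \<le> x \<and> x \<le> t \<and> s < t \<and> t - s < d \<and>
                       inverse (real (Suc k)) * (t - s) < \<bar>W t - W s - (t - s) * f x\<bar>}" for n k
  have si: "set_integrable lborel {s..t} f" for s t
    using f unfolding set_integrable_def by (intro integrable_mult_indicator) auto
  have "negligible (E n k)" for n k
    unfolding E_def
  proof (rule negligible_bad_points_indefinite_integral)
    show "f integrable_on {- real n..real n}"
      using si set_borel_integral_eq_integral(1) by blast
    show "W t - W s = integral {s..t} f" if "s \<le> t" for s t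
      using W[OF that] set_borel_integral_eq_integral(2)[OF si] by simp
  qed auto
  then have neg: "negligible (\<Union>n. \<Union>k. E n k)"
    by (intro negligible_Union_nat negligible_countable_Union) auto
  have der: "(W has_real_derivative f x) (at x)" if x: "x \<notin> (\<Union>n. \<Union>k. E n k)" for x
  proof -
    obtain n :: nat where n: "\<bar>x\<bar> < real n" using reals_Archimedean2 by blast
    have "\<exists>d>0. \<forall>y. y \<noteq> x \<and> \<bar>y - x\<bar> < d \<longrightarrow> \<bar>(W y - W x) / (y - x) - f x\<bar> < e" if e: "e > 0" for e
    proof -
      obtain k where k: "inverse (real (Suc k)) < e" using reals_Archimedean[OF e] by blast
      have "x \<notin> E n k" using x by blast
      then obtain d where d: "d > 0" and le: "\<And>s t. s \<le> x \<Longrightarrow> x \<le> t \<Longrightarrow> s < t \<Longrightarrow> t - s < d \<Longrightarrow>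
          \<bar>W t - W s - (t - s) * f x\<bar> \<le> inverse (real (Suc k)) * (t - s)"
        using n unfolding E_def by (fastforce simp: not_less)
      have "\<bar>(W y - W x) / (y - x) - f x\<bar> < e" if y: "y \<noteq> x" "\<bar>y - x\<bar> < d" for y
      proof -
        have "\<bar>W y - W x - (y - x) * f x\<bar> \<le> inverse (real (Suc k)) * \<bar>y - x\<bar>"
        proof (cases "x < y")
          case True
          then show ?thesis using le[of x y] y by simp
        next
          case False
          then have "\<bar>W x - W y - (x - y) * f x\<bar> \<le> inverse (real (Suc k)) * (x - y)"
            using le[of y x] y by simp
          moreover have "W x - W y - (x - y) * f x = - (W y - W x - (y - x) * f x)"
            by (simp add: algebra_simps)
          ultimately show ?thesis using False by simp
        qed
        then have "\<bar>W y - W x - (y - x) * f x\<bar> / \<bar>y - x\<bar> \<le> inverse (real (Suc k))"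
          using y by (simp add: divide_le_eq)
        moreover have "(W y - W x) / (y - x) - f x = (W y - W x - (y - x) * f x) / (y - x)"
          using y by (simp add: field_simps)
        ultimately show ?thesis using k by simp
      qed
      then show ?thesis using d by blast
    qed
    then show ?thesis
      unfolding has_field_derivative_iff LIM_eq by simp
  qed
  \<comment> \<open>The exceptional set is only known to be Lebesgue null, so the statement is first
    obtained for the completion of \<open>lborel\<close>.\<close>
  have "(\<Union>n. \<Union>k. E n k) \<in> null_sets lebesgue"
    using neg by (simp add: negligible_iff_null_sets)
  then have "AE x in lebesgue. x \<notin> (\<Union>n. \<Union>k. E n k)"
    by (rule AE_not_in)
  then have "AE x in lebesgue. (W has_real_derivative f x) (at x)"
    by (rule AE_mp) (use der in auto)
  then show ?thesis by (simp add: AE_completion_iff)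
qed

section \<open>Functions with absolutely continuous increments\<close>

lemma set_integrable_lborel_if_integrable:
  fixes f :: "real \<Rightarrow> real"
  assumes "integrable lborel f" "A \<in> sets borel"
  shows "set_integrable lborel A f"
  using assms unfolding set_integrable_def by (intro integrable_mult_indicator) auto

lemma indefinite_integral_diff:
  fixes f :: "real \<Rightarrow> real"
  assumes f: "integrable lborel f" and "s \<le> t"
  shows "(LINT y:{..t}|lborel. f y) - (LINT y:{..s}|lborel. f y) = (LINT y:{s..t}|lborel. f y)"
proof -
  have "{..s} \<union> {s<..t} = {..t}" "{..s} \<inter> {s<..t} = {}" using \<open>s \<le> t\<close> by auto
  moreover have "set_lebesgue_integral lborel ({..s} \<union> {s<..t}) f
      = (LINT y:{..s}|lborel. f y) + (LINT y:{s<..t}|lborel. f y)"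
    by (intro set_integral_Un) (use f in \<open>auto intro: set_integrable_lborel_if_integrable\<close>)
  moreover have "(LINT y:{s<..t}|lborel. f y) = (LINT y:{s..t}|lborel. f y)"
    by (rule set_integral_discrete_difference[where X="{s}"]) (use \<open>s \<le> t\<close> in auto)
  ultimately show ?thesis by simp
qed

text \<open>Near each point the function differs by a constant from a Henstock-Kurzweil integral
  over a compact interval, which is continuous in its upper limit.\<close>

lemma continuous_on_indefinite_integral:
  fixes f :: "real \<Rightarrow> real"
  assumes f: "integrable lborel f"
  shows "continuous_on UNIV (\<lambda>x. LINT y:{..x}|lborel. f y)"
proof -
  have "isCont (\<lambda>x. LINT y:{..x}|lborel. f y) x" for x
  proof -
    have si: "set_integrable lborel {s..t} f" for s t
      by (rule set_integrable_lborel_if_integrable) (use f in auto)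
    have "continuous_on {x-1..x+1} (\<lambda>t. integral {x-1..t} f)"
      by (intro indefinite_integral_continuous_1 set_borel_integral_eq_integral(1)[OF si])
    then have "continuous_on {x-1..x+1} (\<lambda>t. (LINT y:{..x-1}|lborel. f y) + integral {x-1..t} f)"
      by (intro continuous_intros)
    also have "?this \<longleftrightarrow> continuous_on {x-1..x+1} (\<lambda>x. LINT y:{..x}|lborel. f y)"
      using indefinite_integral_diff[OF f, of "x-1"] set_borel_integral_eq_integral(2)[OF si]
      by (intro continuous_on_cong refl) fastforce
    finally show ?thesis
      by (rule continuous_on_interior) simp
  qed
  then show ?thesis by (simp add: continuous_on_eq_continuous_at)
qed

text \<open>The sum of the Stieltjes measures of \<open>G\<close> and \<open>H\<close> agrees with
  the density measure on half-open intervals, hence on all Borel sets, and it dominates the measure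
  of \<open>G\<close>.\<close>

lemma interval_measure_le_imp_absolutely_continuous:
  fixes G H :: "real \<Rightarrow> real" and p :: "real \<Rightarrow> ennreal"
  assumes G: "mono G" "continuous_on UNIV G" and H: "mono H" "continuous_on UNIV H"
    and p: "p \<in> borel_measurable lborel"
    and GH: "\<And>s t. s \<le> t \<Longrightarrow> emeasure (density lborel p) {s<..t} = ennreal (G t - G s + (H t - H s))"
  shows "absolutely_continuous lborel (interval_measure G)"
    and "emeasure (interval_measure G) A \<le> emeasure (density lborel p) A"
proof -
  have r: "continuous (at_right a) G" "continuous (at_right a) H" for a
    using G(2) H(2) by (auto simp: continuous_on_eq_continuous_within intro: continuous_within_subset)
  note eG = emeasure_interval_measure_Ioc[OF _ monoD[OF G(1)] r(1)]
  note eH = emeasure_interval_measure_Ioc[OF _ monoD[OF H(1)] r(2)]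
  define P where "P = measure_of UNIV (sets (borel :: real measure))
      (\<lambda>A. emeasure (interval_measure G) A + emeasure (interval_measure H) A)"
  have sP: "sets P = sets borel"
    unfolding P_def by (metis sets.sets_measure_of_eq space_borel)
  have eP: "emeasure P A = emeasure (interval_measure G) A + emeasure (interval_measure H) A"
    if "A \<in> sets borel" for A
    unfolding P_def
  proof (rule emeasure_measure_of_sigma)
    show "sigma_algebra UNIV (sets (borel::real measure))"
      by (metis sets.sigma_algebra_axioms space_borel)
    show "positive (sets borel) (\<lambda>A. emeasure (interval_measure G) A + emeasure (interval_measure H) A)"
      by (simp add: positive_def)
    show "countably_additive (sets borel) (\<lambda>A. emeasure (interval_measure G) A + emeasure (interval_measure H) A)"
      by (auto simp: countably_additive_def suminf_add[symmetric] suminf_emeasure)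
  qed (use that in auto)
  have eq: "P = density lborel p"
  \<comment> \<open>Half-open intervals are stable under intersection and generate the Borel sets;
    the intervals \<open>{-n<..n}\<close> exhaust the line with finite measure.\<close>
  proof (rule measure_eqI_generator_eq[where \<Omega>=UNIV and E="range (\<lambda>(a, b). {a<..b::real})" and A="\<lambda>n. {- real n<..real n}"])
    show "Int_stable (range (\<lambda>(a, b). {a<..b::real}))"
      unfolding Int_stable_def
    proof clarify
      fix a b c d :: real
      have "{a<..b} \<inter> {c<..d} = (\<lambda>(a, b). {a<..b}) (max a c, min b d)" by auto
      then show "{a<..b} \<inter> {c<..d} \<in> range (\<lambda>(a, b). {a<..b})" by (metis rangeI)
    qed
    show "emeasure P X = emeasure (density lborel p) X" if X: "X \<in> range (\<lambda>(a, b). {a<..b})" for X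
    proof -
      obtain a b where ab: "X = {a<..b}" using X by auto
      show ?thesis
      proof (cases "a \<le> b")
        case True
        then show ?thesis
          using monoD[OF G(1) True] monoD[OF H(1) True]
          by (simp add: ab eP eG eH GH ennreal_plus del: ennreal_plus[symmetric])
      qed (simp add: ab)
    qed
    show "sets P = sigma_sets UNIV (range (\<lambda>(a, b). {a<..b}))"
      using sP by (simp add: borel_sigma_sets_Ioc)
    show "sets (density lborel p) = sigma_sets UNIV (range (\<lambda>(a, b). {a<..b}))"
      by (simp add: borel_sigma_sets_Ioc)
    show "(\<Union>i. {- real i<..real i}) = UNIV"
    proof -
      have "\<exists>n::nat. - real n < x \<and> x \<le> real n" for x
        using reals_Archimedean2[of "\<bar>x\<bar>"] by (meson abs_less_iff less_le_not_le minus_less_iff)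
      then show ?thesis by auto
    qed
    show "emeasure P {- real i<..real i} \<noteq> \<infinity>" for i
      by (simp add: eP eG eH)
  qed auto
  show le: "emeasure (interval_measure G) A \<le> emeasure (density lborel p) A" for A
  proof (cases "A \<in> sets borel")
    case True
    then show ?thesis unfolding eq[symmetric] by (simp add: eP)
  qed (simp add: emeasure_notin_sets)
  show "absolutely_continuous lborel (interval_measure G)"
    unfolding absolutely_continuous_def
  proof
    fix A assume A: "A \<in> null_sets (lborel :: real measure)"
    then have "A \<in> null_sets (density lborel p)"
      using absolutely_continuousI_density[OF p] by (auto simp: absolutely_continuous_def)
    with le[of A] A show "A \<in> null_sets (interval_measure G)"
      by (auto simp: null_sets_def)
  qed
qed

text \<open>With \<open>J\<close> a primitive of \<open>m\<close>, the function \<open>J + F\<close>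
  is increasing and its Stieltjes measure lies below the one with density \<open>2 * m\<close>.
  Radon-Nikodym gives it a density \<open>q\<close>, so \<open>F\<close> has the density
  \<open>q - m\<close>.\<close>

proposition ex_density_of_dominated_increments:
  fixes F m :: "real \<Rightarrow> real"
  assumes m: "integrable lborel m" and m0: "\<And>x. 0 \<le> m x"
    and F: "\<And>s t. s \<le> t \<Longrightarrow> \<bar>F t - F s\<bar> \<le> (LINT y:{s..t}|lborel. m y)"
  obtains w where "integrable lborel w" "\<And>s t. s \<le> t \<Longrightarrow> F t - F s = (LINT y:{s..t}|lborel. w y)"
proof -
  define J where "J x = (LINT y:{..x}|lborel. m y)" for x
  have J: "J t - J s = (LINT y:{s..t}|lborel. m y)" if "s \<le> t" for s t
    using indefinite_integral_diff[OF m that] by (simp add: J_def)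
  have FJ: "\<bar>F t - F s\<bar> \<le> J t - J s" if "s \<le> t" for s t
    using F[OF that] J[OF that] by simp
  have cJ: "continuous_on UNIV J"
    unfolding J_def using continuous_on_indefinite_integral[OF m] .
  have cF: "continuous_on UNIV F"
    unfolding continuous_on_iff
  proof (intro ballI allI impI)
    fix x e :: real assume "e > 0"
    then obtain d where d: "d > 0" "\<And>y. dist y x < d \<Longrightarrow> dist (J y) (J x) < e"
      using cJ unfolding continuous_on_iff by blast
    have "dist (F y) (F x) \<le> dist (J y) (J x)" for y
      using FJ[of x y] FJ[of y x] by (cases "x \<le> y") (auto simp: dist_real_def)
    then show "\<exists>d>0. \<forall>y\<in>UNIV. dist y x < d \<longrightarrow> dist (F y) (F x) < e"
      using d by (meson le_less_trans)
  qed
  \<comment> \<open>Domination makes both functions increasing. Their sum is \<open>2 * J\<close>,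
    which explains the factor 2 in the density below.\<close>
  define G H where "G x = J x + F x" and "H x = J x - F x" for x
  have G: "mono G" "continuous_on UNIV G" and H: "mono H" "continuous_on UNIV H"
  proof -
    have "G s \<le> G t" "H s \<le> H t" if "s \<le> t" for s t
      using FJ[OF that] by (auto simp: G_def H_def)
    then show "mono G" "mono H" by (auto intro: monoI)
    show "continuous_on UNIV G" "continuous_on UNIV H"
      unfolding G_def H_def by (intro continuous_intros cJ cF)+
  qed
  have dens: "emeasure (density lborel (\<lambda>x. ennreal (2 * m x))) A = ennreal (LINT y:A|lborel. 2 * m y)"
    if "A \<in> sets borel" for A
  proof -
    have "emeasure (density lborel (\<lambda>x. ennreal (2 * m x))) A = (\<integral>\<^sup>+x. ennreal (2 * m x) * indicator A x \<partial>lborel)"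
      using m that by (intro emeasure_density) auto
    also have "\<dots> = (\<integral>\<^sup>+x. ennreal (indicator A x * (2 * m x)) \<partial>lborel)"
      by (intro nn_integral_cong) (auto split: split_indicator)
    also have "\<dots> = ennreal (LINT y:A|lborel. 2 * m y)"
      unfolding set_lebesgue_integral_def
      using set_integrable_lborel_if_integrable[of "\<lambda>x. 2 * m x" A] m that m0
      by (subst nn_integral_eq_integral) (auto simp: set_integrable_def)
    finally show ?thesis .
  qed
  have GH: "emeasure (density lborel (\<lambda>x. ennreal (2 * m x))) {s<..t} = ennreal (G t - G s + (H t - H s))"
    if "s \<le> t" for s t
  proof -
    have "(LINT y:{s<..t}|lborel. m y) = (LINT y:{s..t}|lborel. m y)"
      by (rule set_integral_discrete_difference[where X="{s}"]) (use that in auto)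
    then have "(LINT y:{s<..t}|lborel. m y) = J t - J s"
      using J[OF that] by simp
    then show ?thesis
      by (subst dens) (simp_all add: G_def H_def)
  qed
  have pm: "(\<lambda>x. ennreal (2 * m x)) \<in> borel_measurable lborel"
    using m by measurable
  note ac = interval_measure_le_imp_absolutely_continuous[OF G H pm GH]
  obtain p where p: "p \<in> borel_measurable lborel" "density lborel p = interval_measure G"
    using sigma_finite_measure.Radon_Nikodym[OF lborel.sigma_finite_measure_axioms ac(1)] by auto
  have "(\<integral>\<^sup>+x. p x \<partial>lborel) = emeasure (interval_measure G) UNIV"
    unfolding p(2)[symmetric] using p(1) by (subst emeasure_density) auto
  also have "\<dots> \<le> ennreal (LINT y:UNIV|lborel. 2 * m y)"
    using ac(2)[of UNIV] dens[of UNIV] by simp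
  finally have fin: "(\<integral>\<^sup>+x. p x \<partial>lborel) < \<infinity>"
    by (simp add: le_less_trans)
  then have pfin: "AE x in lborel. p x \<noteq> \<infinity>"
    using nn_integral_PInf_AE[OF p(1)] by auto
  \<comment> \<open>The density \<open>p\<close> has finite total mass and is therefore finite
    almost everywhere, so replacing it by a real function changes it on a null set only.\<close>
  define q where "q x = enn2real (p x)" for x
  have pq: "AE x in lborel. p x = ennreal (q x)"
    using pfin by eventually_elim (auto simp: q_def ennreal_enn2real_if)
  have "(\<integral>\<^sup>+x. ennreal (q x) \<partial>lborel) = (\<integral>\<^sup>+x. p x \<partial>lborel)"
    using pq by (intro nn_integral_cong_AE) auto
  then have q: "integrable lborel q"
    using fin p(1) by (intro integrableI_nonneg) (auto simp: q_def[abs_def])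
  have Gq: "G t - G s = (LINT y:{s..t}|lborel. q y)" if "s \<le> t" for s t
  proof -
    have "ennreal (G t - G s) = emeasure (density lborel p) {s..t}"
      unfolding p(2) using that G by (subst emeasure_interval_measure_Icc) (auto dest: monoD)
    also have "\<dots> = (\<integral>\<^sup>+x. p x * indicator {s..t} x \<partial>lborel)"
      using p(1) by (intro emeasure_density) auto
    also have "\<dots> = (\<integral>\<^sup>+x. ennreal (indicator {s..t} x * q x) \<partial>lborel)"
      using pq by (intro nn_integral_cong_AE) (auto split: split_indicator)
    also have "\<dots> = ennreal (LINT y:{s..t}|lborel. q y)"
      unfolding set_lebesgue_integral_def
      using set_integrable_lborel_if_integrable[OF q, of "{s..t}"]
      by (subst nn_integral_eq_integral) (auto simp: set_integrable_def q_def)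
    finally show ?thesis
      using monoD[OF G(1) that]
      by (subst (asm) ennreal_inj) (auto simp: set_lebesgue_integral_def q_def intro!: integral_nonneg_AE)
  qed
  show ?thesis
  proof
    show "integrable lborel (\<lambda>x. q x - m x)" using q m by simp
    fix s t :: real assume st: "s \<le> t"
    have "F t - F s = (G t - G s) - (J t - J s)" by (simp add: G_def)
    then show "F t - F s = (LINT y:{s..t}|lborel. q y - m y)"
      using Gq[OF st] J[OF st] q m
      by (subst set_integral_diff) (auto intro: set_integrable_lborel_if_integrable)
  qed
qed

section \<open>The metric derivative\<close>

lemma tendsto_abs_difference_quotient:
  fixes f :: "real \<Rightarrow> real"
  assumes "(f has_real_derivative D) (at t)"
  shows "((\<lambda>h. \<bar>f (t + h) - f t\<bar> / \<bar>h\<bar>) \<longlongrightarrow> \<bar>D\<bar>) (at 0)"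
  using tendsto_rabs[OF assms[unfolded DERIV_def]] by (simp add: abs_divide)

text \<open>Difference quotients of \<open>v\<close> are squeezed: from below by those of each
  \<open>f q\<close>, whose increments never exceed the distance, and from above by those of a
  primitive of \<open>M\<close>.\<close>

proposition metric_derivative_exists_AE:
  fixes v :: "real \<Rightarrow> 'a::metric_space" and m :: "real \<Rightarrow> real"
  assumes m: "integrable lborel m" and m0: "\<And>x. 0 \<le> m x"
    and v: "\<And>s t. s \<le> t \<Longrightarrow> dist (v t) (v s) \<le> (LINT y:{s..t}|lborel. m y)"
  obtains M where "integrable lborel M" "\<And>x. 0 \<le> M x"
    "\<And>s t. s \<le> t \<Longrightarrow> dist (v t) (v s) \<le> (LINT y:{s..t}|lborel. M y)"
    "AE t in lborel. ((\<lambda>h. dist (v (t + h)) (v t) / \<bar>h\<bar>) \<longlongrightarrow> M t) (at 0)"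
proof -
  define J where "J x = (LINT y:{..x}|lborel. m y)" for x
  have J: "J t - J s = (LINT y:{s..t}|lborel. m y)" if "s \<le> t" for s t
    using indefinite_integral_diff[OF m that] by (simp add: J_def)
  have vJ: "dist (v t) (v s) \<le> \<bar>J t - J s\<bar>" for s t
    using v[of s t] J[of s t] v[of t s] J[of t s]
    by (cases "s \<le> t") (auto simp: dist_commute)
  \<comment> \<open>The values at rational times are dense in the curve, so countably many distance
    functions recover the metric along it.\<close>
  define f where "f q t = dist (v t) (v (real_of_rat q))" for q t
  have fv: "\<bar>f q t - f q s\<bar> \<le> dist (v t) (v s)" for q s t
    unfolding f_def by (metis abs_dist_diff_le dist_commute)
  have "\<exists>w. integrable lborel w \<and> (\<forall>s t. s \<le> t \<longrightarrow> f q t - f q s = (LINT y:{s..t}|lborel. w y))" for q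
    using ex_density_of_dominated_increments[OF m m0, of "f q"] order_trans[OF fv v] by metis
  then obtain w0 where w0: "\<And>q. integrable lborel (w0 q)"
    "\<And>q s t. s \<le> t \<Longrightarrow> f q t - f q s = (LINT y:{s..t}|lborel. w0 q y)" by metis
  have dJ: "AE t in lborel. (J has_real_derivative m t) (at t)"
    by (rule AE_has_derivative_indefinite_integral[OF m J])
  have df: "AE t in lborel. \<forall>q. (f q has_real_derivative w0 q t) (at t)"
    unfolding AE_all_countable using AE_has_derivative_indefinite_integral[OF w0] by blast
  have le: "AE t in lborel. \<forall>q. \<bar>w0 q t\<bar> \<le> m t"
    using dJ df
  proof eventually_elim
    case (elim t)
    show ?case
    proof
      fix q
      have "\<bar>w0 q t\<bar> \<le> \<bar>m t\<bar>"
      proof (rule tendsto_le[OF _ tendsto_abs_difference_quotient tendsto_abs_difference_quotient])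
        show "\<forall>\<^sub>F h in at 0. \<bar>f q (t + h) - f q t\<bar> / \<bar>h\<bar> \<le> \<bar>J (t + h) - J t\<bar> / \<bar>h\<bar>"
          by (intro always_eventually allI divide_right_mono order_trans[OF fv vJ]) auto
      qed (use elim in auto)
      then show "\<bar>w0 q t\<bar> \<le> m t" using m0[of t] by simp
    qed
  qed
  \<comment> \<open>The cut-off makes the bound by \<open>m\<close> hold everywhere rather than
    almost everywhere, so the supremum defining \<open>M\<close> is finite at every point.\<close>
  define w where "w q t = (if \<bar>w0 q t\<bar> \<le> m t then w0 q t else 0)" for q t
  have w0w: "AE t in lborel. \<forall>q. w0 q t = w q t"
    using le by eventually_elim (simp add: w_def)
  have wm: "\<bar>w q t\<bar> \<le> m t" for q t
    using m0[of t] by (simp add: w_def)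
  have [measurable]: "w0 q \<in> borel_measurable borel" "m \<in> borel_measurable borel" for q
    using w0(1)[of q] m by auto
  have wmeas [measurable]: "w q \<in> borel_measurable borel" for q
    unfolding w_def by measurable
  have wint: "integrable lborel (w q)" for q
    using m by (rule Bochner_Integration.integrable_bound) (use wm m0 in auto)
  define M where "M t = (SUP q. \<bar>w q t\<bar>)" for t
  have bdd: "bdd_above (range (\<lambda>q. \<bar>w q t\<bar>))" for t
    by (rule bdd_aboveI2[where M="m t"]) (rule wm)
  have wM: "\<bar>w q t\<bar> \<le> M t" for q t
    unfolding M_def by (rule cSUP_upper[OF UNIV_I bdd])
  have M0: "0 \<le> M t" for t
    using wM[of 0 t] by linarith
  have Mm: "M t \<le> m t" for t
    unfolding M_def using wm by (intro cSUP_least) auto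
  have Mmeas [measurable]: "M \<in> borel_measurable borel"
    unfolding M_def using bdd by (intro borel_measurable_cSUP) auto
  have Mint: "integrable lborel M"
    using m by (rule Bochner_Integration.integrable_bound) (use M0 Mm m0 in auto)
  have fw: "f q t - f q s = (LINT y:{s..t}|lborel. w q y)" if "s \<le> t" for q s t
    unfolding w0(2)[OF that]
    by (rule set_lebesgue_integral_cong_AE) (use w0w in auto)
  have fM: "\<bar>f q t - f q s\<bar> \<le> (LINT y:{s..t}|lborel. M y)" if "s \<le> t" for q s t
  proof -
    have "\<bar>LINT y:{s..t}|lborel. w q y\<bar> \<le> (LINT y:{s..t}|lborel. \<bar>w q y\<bar>)"
      using set_integral_norm_bound[of lborel "{s..t}" "w q"] wint set_integrable_lborel_if_integrable by auto
    also have "\<dots> \<le> (LINT y:{s..t}|lborel. M y)"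
      using wint Mint wM by (intro set_integral_mono set_integrable_lborel_if_integrable) auto
    finally show ?thesis unfolding fw[OF that] .
  qed
  have vM: "dist (v t) (v s) \<le> (LINT y:{s..t}|lborel. M y)" if "s \<le> t" for s t
  proof (rule field_le_epsilon)
    fix e :: real assume "e > 0"
    have "isCont J s"
      unfolding J_def using continuous_on_indefinite_integral[OF m]
      by (simp add: continuous_on_eq_continuous_at)
    then obtain d where d: "d > 0" "\<And>y. dist y s < d \<Longrightarrow> dist (J y) (J s) < e / 2"
      unfolding continuous_at_eps_delta using \<open>e > 0\<close> by (metis dist_commute half_gt_zero)
    \<comment> \<open>A rational time just after \<open>s\<close> makes \<open>f q s\<close> smaller
      than \<open>e / 2\<close>. As \<open>f q t + f q s\<close> equals
      \<open>(f q t - f q s) + 2 * f q s\<close>, the distance exceeds the integral by less than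
      \<open>e\<close>.\<close>
    obtain q where "s < real_of_rat q" "real_of_rat q < s + d"
      using of_rat_dense[of s "s + d"] d(1) by auto
    then have "dist (J (real_of_rat q)) (J s) < e / 2"
      by (intro d(2)) (simp add: dist_real_def)
    then have "dist (v s) (v (real_of_rat q)) < e / 2"
      using vJ[of s "real_of_rat q"] by (simp add: dist_real_def abs_minus_commute)
    moreover have "dist (v t) (v s) \<le> f q t + f q s"
      unfolding f_def by (rule dist_triangle2)
    ultimately show "dist (v t) (v s) \<le> (LINT y:{s..t}|lborel. M y) + e"
      using fM[OF that, of q] unfolding f_def by linarith
  qed
  define K where "K x = (LINT y:{..x}|lborel. M y)" for x
  have K: "K t - K s = (LINT y:{s..t}|lborel. M y)" if "s \<le> t" for s t
    using indefinite_integral_diff[OF Mint that] by (simp add: K_def)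
  have vK: "dist (v t) (v s) \<le> \<bar>K t - K s\<bar>" for s t
    using vM[of s t] K[of s t] vM[of t s] K[of t s]
    by (cases "s \<le> t") (auto simp: dist_commute)
  have dK: "AE t in lborel. (K has_real_derivative M t) (at t)"
    by (rule AE_has_derivative_indefinite_integral[OF Mint K])
  have "AE t in lborel. ((\<lambda>h. dist (v (t + h)) (v t) / \<bar>h\<bar>) \<longlongrightarrow> M t) (at 0)"
    using dK df w0w
  proof eventually_elim
    case (elim t)
    show ?case
    proof (rule order_tendstoI)
      fix a assume "a < M t"
      then obtain q where q: "a < \<bar>w q t\<bar>"
        unfolding M_def using less_cSUP_iff[OF _ bdd] by auto
      have "((\<lambda>h. \<bar>f q (t + h) - f q t\<bar> / \<bar>h\<bar>) \<longlongrightarrow> \<bar>w q t\<bar>) (at 0)"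
        using elim by (intro tendsto_abs_difference_quotient) auto
      then have "\<forall>\<^sub>F h in at 0. a < \<bar>f q (t + h) - f q t\<bar> / \<bar>h\<bar>"
        using q by (rule order_tendstoD)
      then show "\<forall>\<^sub>F h in at 0. a < dist (v (t + h)) (v t) / \<bar>h\<bar>"
        by (rule eventually_mono) (meson abs_ge_zero divide_right_mono fv order_less_le_trans)
    next
      fix a assume "M t < a"
      moreover have "((\<lambda>h. \<bar>K (t + h) - K t\<bar> / \<bar>h\<bar>) \<longlongrightarrow> M t) (at 0)"
        using tendsto_abs_difference_quotient[of K "M t" t] elim M0 by simp
      ultimately have "\<forall>\<^sub>F h in at 0. \<bar>K (t + h) - K t\<bar> / \<bar>h\<bar> < a"
        using order_tendstoD by blast
      then show "\<forall>\<^sub>F h in at 0. dist (v (t + h)) (v t) / \<bar>h\<bar> < a"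
        by (rule eventually_mono) (meson abs_ge_zero divide_right_mono vK order_le_less_trans)
    qed
  qed
  then show ?thesis using that Mint M0 vM by blast
qed

section \<open>Translation and smallness of integrals of nonnegative functions\<close>

text \<open>Stated for arbitrary \<open>f\<close> because it is applied to integrands containing
  \<open>metric_derivative\<close>, which is only known to agree almost everywhere with a Borel
  function. The integral is a supremum over simple functions below \<open>f\<close>, and those can
  be shifted.\<close>

lemma nn_integral_lborel_translation:
  fixes f :: "real \<Rightarrow> ennreal"
  shows "(\<integral>\<^sup>+x. f (a + x) \<partial>lborel) = (\<integral>\<^sup>+x. f x \<partial>lborel)"
proof -
  have le: "(\<integral>\<^sup>+x. f (a + x) \<partial>lborel) \<le> (\<integral>\<^sup>+x. f x \<partial>lborel)" for f :: "real \<Rightarrow> ennreal" and a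
    unfolding nn_integral_def[of lborel "\<lambda>x. f (a + x)"]
  proof (rule SUP_least)
    fix g assume "g \<in> {g. simple_function lborel g \<and> g \<le> (\<lambda>x. f (a + x))}"
    then have g: "simple_function lborel g" "\<And>x. g x \<le> f (a + x)" by (auto simp: le_fun_def)
    have [measurable]: "g \<in> borel_measurable borel"
      using borel_measurable_simple_function[OF g(1)] by simp
    have "integral\<^sup>S lborel g = (\<integral>\<^sup>+x. g x \<partial>lborel)"
      using g(1) by (simp add: nn_integral_eq_simple_integral)
    also have "\<dots> = (\<integral>\<^sup>+x. g (- a + (a + x)) \<partial>lborel)" by simp
    also have "\<dots> = (\<integral>\<^sup>+x. g (- a + x) \<partial>distr lborel borel ((+) a))"
      by (subst nn_integral_distr) auto
    also have "\<dots> = (\<integral>\<^sup>+x. g (- a + x) \<partial>lborel)"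
      by (simp only: lborel_distr_plus)
    also have "\<dots> \<le> (\<integral>\<^sup>+x. f x \<partial>lborel)"
      using g(2)[of "- a + _"] by (intro nn_integral_mono) (metis add.commute add_minus_cancel)
    finally show "integral\<^sup>S lborel g \<le> (\<integral>\<^sup>+x. f x \<partial>lborel)" .
  qed
  show ?thesis
  proof (rule antisym[OF le])
    show "(\<integral>\<^sup>+x. f x \<partial>lborel) \<le> (\<integral>\<^sup>+x. f (a + x) \<partial>lborel)"
      using le[of "\<lambda>x. f (a + x)" "- a"] by simp
  qed
qed

lemma set_nn_integral_lborel_translation:
  fixes f :: "real \<Rightarrow> ennreal"
  shows "(\<integral>\<^sup>+x\<in>{s..t}. f (a + x) \<partial>lborel) = (\<integral>\<^sup>+x\<in>{a+s..a+t}. f x \<partial>lborel)"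
  using nn_integral_lborel_translation[of "\<lambda>x. f x * indicator {a+s..a+t} x" a]
  by (simp add: indicator_def)

text \<open>Continuity from above of the measure with density \<open>P\<close>, along intervals that
  shrink to the null set \<open>{t}\<close>.\<close>

lemma ex_small_set_nn_integral:
  fixes P :: "real \<Rightarrow> ennreal"
  assumes P: "P \<in> borel_measurable borel" and fin: "(\<integral>\<^sup>+r\<in>{t..t+1}. P r \<partial>lborel) < \<infinity>" and "e > 0"
  obtains h where "0 < h" "h \<le> 1" "(\<integral>\<^sup>+r\<in>{t..t+h}. P r \<partial>lborel) < e"
proof -
  define A where "A n = {t..t + inverse (real (Suc n))}" for n
  define N where "N = density lborel P"
  have eN: "emeasure N S = (\<integral>\<^sup>+r\<in>S. P r \<partial>lborel)" if "S \<in> sets borel" for S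
    unfolding N_def using P that by (intro emeasure_density) auto
  have le1: "inverse (real (Suc n)) \<le> 1" for n
    by (simp add: inverse_le_1_iff)
  have "(\<lambda>n. emeasure N (A n)) \<longlonglongrightarrow> emeasure N (\<Inter>n. A n)"
  proof (rule Lim_emeasure_decseq)
    show "range A \<subseteq> sets N" by (auto simp: A_def N_def)
    show "decseq A"
      unfolding decseq_def A_def using le_imp_inverse_le by (auto intro: order_trans)
    show "emeasure N (A n) \<noteq> \<infinity>" for n
    proof -
      have "emeasure N (A n) \<le> emeasure N {t..t+1}"
        using le1[of n] by (intro emeasure_mono) (auto simp: A_def N_def)
      then show ?thesis using fin eN[of "{t..t+1}"] by (auto simp: top_unique)
    qed
  qed
  also have "(\<Inter>n. A n) = {t}"
  proof -
    have "x = t" if "\<And>n. x \<in> A n" for x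
    proof (rule ccontr)
      assume "x \<noteq> t"
      with that[of 0] have "x - t > 0" by (simp add: A_def)
      then obtain n where "inverse (real (Suc n)) < x - t" using reals_Archimedean by blast
      with that[of n] show False by (simp add: A_def)
    qed
    moreover have "t \<in> A n" for n by (simp add: A_def)
    ultimately show ?thesis by auto
  qed
  also have "emeasure N {t} = 0"
  proof -
    have "(\<integral>\<^sup>+r\<in>{t}. P r \<partial>lborel) = (\<integral>\<^sup>+r. 0 \<partial>(lborel :: real measure))"
      using AE_lborel_singleton[of t] by (intro nn_integral_cong_AE) (auto simp: indicator_def)
    then show ?thesis by (simp add: eN)
  qed
  finally have "\<forall>\<^sub>F n in sequentially. emeasure N (A n) < e"
    using \<open>e > 0\<close> by (rule order_tendstoD)
  then obtain n where "emeasure N (A n) < e" by (meson eventually_sequentially order_refl)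
  then show ?thesis
    using that[of "inverse (real (Suc n))"] le1[of n] eN[of "A n"] by (simp add: A_def)
qed

section \<open>Continuity and metric derivative of locally absolutely continuous curves\<close>

lemma loc_abs_continuous_imp_isCont:
  assumes v: "loc_abs_continuous v" and "0 < t"
  shows "isCont v t"
proof -
  obtain m where m: "\<And>a b. 0 < a \<Longrightarrow> a \<le> b \<Longrightarrow> set_integrable lborel {a..b} m"
    "\<And>s t. 0 < s \<Longrightarrow> s \<le> t \<Longrightarrow> dist (v t) (v s) \<le> (LINT r:{s..t}|lborel. m r)"
    using v unfolding loc_abs_continuous_def by blast
  define a b where "a = t / 2" and "b = t + 1"
  have ab: "0 < a" "a < t" "t < b" using \<open>0 < t\<close> by (auto simp: a_def b_def)
  define I where "I x = integral {a..x} m" for x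
  have int: "m integrable_on {s..r}" if "a \<le> s" "s \<le> r" for s r
    using m(1)[of s r] that ab set_borel_integral_eq_integral(1) by auto
  have cI: "continuous_on {a..b} I"
    unfolding I_def by (rule indefinite_integral_continuous_1) (use ab int in auto)
  have le: "dist (v r) (v s) \<le> I r - I s" if "a \<le> s" "s \<le> r" for s r
  proof -
    have "I r = I s + integral {s..r} m"
      unfolding I_def using Henstock_Kurzweil_Integration.integral_combine[OF that int[of a r]] that by simp
    then show ?thesis
      using m(2)[of s r] set_borel_integral_eq_integral(2)[OF m(1)[of s r]] that ab by simp
  qed
  have "continuous_on {a..b} v"
    unfolding continuous_on_iff
  proof (intro ballI allI impI)
    fix x e :: real assume "x \<in> {a..b}" "e > 0"
    then obtain d where d: "d > 0" "\<And>y. y \<in> {a..b} \<Longrightarrow> dist y x < d \<Longrightarrow> dist (I y) (I x) < e"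
      using cI unfolding continuous_on_iff by blast
    have "dist (v y) (v x) \<le> dist (I y) (I x)" if "y \<in> {a..b}" for y
      using le[of x y] le[of y x] that \<open>x \<in> {a..b}\<close>
      by (cases "x \<le> y") (auto simp: dist_real_def dist_commute)
    then show "\<exists>d>0. \<forall>y\<in>{a..b}. dist y x < d \<longrightarrow> dist (v y) (v x) < e"
      using d by (meson le_less_trans)
  qed
  then show ?thesis
    by (rule continuous_on_interior) (use ab in auto)
qed

text \<open>Provides a Borel version \<open>M\<close> of the metric derivative on a compact window.
  Freezing the curve outside the window makes the dominating function integrable on the whole line,
  as the global result requires.\<close>

lemma loc_abs_continuous_metric_derivative:
  assumes v: "loc_abs_continuous v" and "0 < a" "a < b"
  obtains M :: "real \<Rightarrow> real" where "M \<in> borel_measurable borel" "\<And>x. 0 \<le> M x"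
    "AE r in lborel. r \<in> {a..b} \<longrightarrow> metric_derivative v r = M r"
    "\<And>s t. a \<le> s \<Longrightarrow> s \<le> t \<Longrightarrow> t \<le> b \<Longrightarrow>
      ennreal (dist (v t) (v s)) \<le> (\<integral>\<^sup>+r\<in>{s..t}. ennreal (M r) \<partial>lborel)"
proof -
  obtain m where m: "\<And>r. r > 0 \<Longrightarrow> 0 \<le> m r" "\<And>a b. 0 < a \<Longrightarrow> a \<le> b \<Longrightarrow> set_integrable lborel {a..b} m"
    "\<And>s t. 0 < s \<Longrightarrow> s \<le> t \<Longrightarrow> dist (v t) (v s) \<le> (LINT r:{s..t}|lborel. m r)"
    using v unfolding loc_abs_continuous_def by blast
  define c where "c r = max a (min b r)" for r :: real
  define v' where "v' r = v (c r)" for r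
  define m' where "m' r = indicator {a..b} r * m r" for r
  have m'int: "integrable lborel m'"
    using m(2)[of a b] assms by (simp add: m'_def[abs_def] set_integrable_def)
  have m'0: "0 \<le> m' x" for x
    using m(1)[of x] assms by (auto simp: m'_def indicator_def)
  have v'm': "dist (v' t) (v' s) \<le> (LINT y:{s..t}|lborel. m' y)" if "s \<le> t" for s t
  \<comment> \<open>If \<open>{s..t}\<close> meets the window, clamping its endpoints yields the
    intersection; otherwise the clamped curve does not move between \<open>s\<close> and
    \<open>t\<close>.\<close>
  proof (cases "s \<le> b \<and> a \<le> t")
    case True
    then have c: "{c s..c t} = {s..t} \<inter> {a..b}"
      using that assms by (auto simp: c_def)
    have "(LINT y:{c s..c t}|lborel. m y) = (LINT y:{s..t}|lborel. m' y)"
      unfolding c by (simp only: set_lebesgue_integral_def m'_def indicator_inter_arith mult.assoc real_scaleR_def)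
    moreover have "0 < c s" "c s \<le> c t"
      using that assms by (auto simp: c_def)
    ultimately show ?thesis using m(3)[of "c s" "c t"] by (simp add: v'_def)
  next
    case False
    then have "c s = c t" using that assms by (auto simp: c_def)
    moreover have "0 \<le> (LINT y:{s..t}|lborel. m' y)"
      using m'0 by (simp add: set_lebesgue_integral_def)
    ultimately show ?thesis by (simp add: v'_def)
  qed
  obtain M where M: "integrable lborel M" "\<And>x. 0 \<le> M x"
    "\<And>s t. s \<le> t \<Longrightarrow> dist (v' t) (v' s) \<le> (LINT y:{s..t}|lborel. M y)"
    "AE t in lborel. ((\<lambda>h. dist (v' (t + h)) (v' t) / \<bar>h\<bar>) \<longlongrightarrow> M t) (at 0)"
    by (rule metric_derivative_exists_AE[OF m'int m'0 v'm']) blast+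
  show ?thesis
  proof
    show "M \<in> borel_measurable borel" using M(1) by auto
    show "0 \<le> M x" for x by (rule M(2))
    show "AE r in lborel. r \<in> {a..b} \<longrightarrow> metric_derivative v r = M r"
      using M(4) AE_lborel_singleton[of a] AE_lborel_singleton[of b]
    proof eventually_elim
      case (elim r)
      show ?case
      proof
        assume "r \<in> {a..b}"
        with elim have r: "a < r" "r < b" by auto
        \<comment> \<open>Clamped and original curve coincide near interior points; the two
          endpoints, where they may have different difference quotients, form a null set.\<close>
        have "\<forall>\<^sub>F h in at 0. dist (v' (r + h)) (v' r) / \<bar>h\<bar> = dist (v (r + h)) (v r) / \<bar>h\<bar>"
          unfolding eventually_at
          by (rule exI[of _ "min (r - a) (b - r)"]) (use r in \<open>auto simp: v'_def c_def dist_real_def\<close>)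
        then have "((\<lambda>h. dist (v (r + h)) (v r) / \<bar>h\<bar>) \<longlongrightarrow> M r) (at 0)"
          using elim(1) by (rule Lim_transform_eventually[rotated])
        then show "metric_derivative v r = M r"
          unfolding metric_derivative_def by (intro tendsto_Lim) auto
      qed
    qed
    fix s t assume st: "a \<le> s" "s \<le> t" "t \<le> b"
    then have "v' t = v t" "v' s = v s" by (auto simp: v'_def c_def)
    then have "ennreal (dist (v t) (v s)) \<le> ennreal (LINT y:{s..t}|lborel. M y)"
      using M(3)[OF st(2)] by (simp add: ennreal_leI)
    also have "\<dots> = (\<integral>\<^sup>+r\<in>{s..t}. ennreal (M r) \<partial>lborel)"
      using set_integrable_lborel_if_integrable[OF M(1), of "{s..t}"] M(2)
      unfolding set_lebesgue_integral_def
      by (subst nn_integral_eq_integral[symmetric])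
        (auto simp: set_integrable_def indicator_def intro!: nn_integral_cong)
    finally show "ennreal (dist (v t) (v s)) \<le> (\<integral>\<^sup>+r\<in>{s..t}. ennreal (M r) \<partial>lborel)" .
  qed
qed

section \<open>Gradient flows\<close>

text \<open>The indicator discards the arbitrary values of \<open>v\<close> at nonpositive times, so
  that measurability holds on the whole line.\<close>

lemma upper_gradient_measurable:
  assumes "upper_gradient \<Phi> g" "loc_abs_continuous v" "\<forall>t>0. v t \<in> effective_domain \<Phi>"
  shows "(\<lambda>r. g (v r) * indicator {0<..} r) \<in> borel_measurable borel"
  using assms borel_measurable_restrict_space_iff_ennreal[of "{0<..}" borel "\<lambda>r. g (v r)"]
  unfolding upper_gradient_def by auto

section \<open>Restarting a flow at a positive time\<close>

lemma loc_abs_continuous_translate: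
  assumes "loc_abs_continuous v" "0 < a"
  shows "loc_abs_continuous (\<lambda>r. v (a + r))"
proof -
  obtain m where m: "\<And>r. r > 0 \<Longrightarrow> 0 \<le> m r" "\<And>a b. 0 < a \<Longrightarrow> a \<le> b \<Longrightarrow> set_integrable lborel {a..b} m"
    "\<And>s t. 0 < s \<Longrightarrow> s \<le> t \<Longrightarrow> dist (v t) (v s) \<le> (LINT r:{s..t}|lborel. m r)"
    using assms(1) unfolding loc_abs_continuous_def by blast
  have ind: "indicator {a+s..a+t} (a + r) = (indicator {s..t} r :: real)" for s t r
    by (simp add: indicator_def)
  have "set_integrable lborel {s..t} (\<lambda>r. m (a + r))" if "0 < s" "s \<le> t" for s t
    using lborel_integrable_real_affine[OF m(2)[of "a+s" "a+t", unfolded set_integrable_def], of 1 a] that assms(2)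
    by (simp add: set_integrable_def ind)
  moreover have "dist (v (a + t)) (v (a + s)) \<le> (LINT r:{s..t}|lborel. m (a + r))" if "0 < s" "s \<le> t" for s t
    using m(3)[of "a+s" "a+t"] that assms(2)
      lborel_integral_real_affine[of 1 "\<lambda>r. indicator {a+s..a+t} r *\<^sub>R m r" a]
    by (simp add: set_lebesgue_integral_def ind)
  ultimately show ?thesis
    unfolding loc_abs_continuous_def using m(1) assms(2)
    by (intro exI[of _ "\<lambda>r. m (a + r)"]) auto
qed

lemma oriented_integral_translate:
  "oriented_integral s t (\<lambda>r. f (a + r)) = oriented_integral (a + s) (a + t) f"
  by (simp add: oriented_integral_def set_nn_integral_lborel_translation)

lemma gradient_flow_translate:
  assumes v: "gradient_flow \<Phi> g v" and a: "0 < a"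
  shows "gradient_flow \<Phi> g (\<lambda>r. v (a + r))"
proof -
  have md: "metric_derivative (\<lambda>r. v (a + r)) = (\<lambda>r. metric_derivative v (a + r))"
    by (simp add: metric_derivative_def fun_eq_iff add.assoc)
  have "\<Phi> (v (a + t)) - \<Phi> (v (a + s)) \<le>
          - (ereal (1/2) * oriented_integral s t (\<lambda>r. (ennreal (metric_derivative v (a + r)))\<^sup>2))
          - ereal (1/2) * oriented_integral s t (\<lambda>r. (g (v (a + r)))\<^sup>2)" if "s > 0" "t > 0" for s t
    using v that a unfolding gradient_flow_def
      oriented_integral_translate[where f="\<lambda>r. (ennreal (metric_derivative v r))\<^sup>2"]
      oriented_integral_translate[where f="\<lambda>r. (g (v r))\<^sup>2"] by simp
  then show ?thesis
    unfolding gradient_flow_def md using v a loc_abs_continuous_translate[of v a]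
    by (auto simp: gradient_flow_def)
qed

section \<open>Energy dissipation along a flow\<close>

lemma gradient_flow_finite:
  assumes "\<And>x. \<Phi> x \<noteq> -\<infinity>" "gradient_flow \<Phi> g v" "0 < t"
  shows "\<Phi> (v t) = ereal (real_of_ereal (\<Phi> (v t)))"
  using assms(1)[of "v t"] assms(2,3)
  by (cases "\<Phi> (v t)") (auto simp: gradient_flow_def effective_domain_def)

text \<open>Equality results from the energy inequality for both orders of the two times: exchanging
  them reverses the sign of every term.\<close>

lemma gradient_flow_energy_identity:
  fixes \<Phi> :: "'a::metric_space \<Rightarrow> ereal"
  assumes \<Phi>: "\<And>x. \<Phi> x \<noteq> -\<infinity>" and v: "gradient_flow \<Phi> g v" and st: "0 < s" "s < t"
  shows "(\<integral>\<^sup>+r\<in>{s..t}. (ennreal (metric_derivative v r))\<^sup>2 \<partial>lborel) + (\<integral>\<^sup>+r\<in>{s..t}. (g (v r))\<^sup>2 \<partial>lborel)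
      = ennreal (2 * (real_of_ereal (\<Phi> (v s)) - real_of_ereal (\<Phi> (v t))))" (is "?A + ?B = _")
    and "real_of_ereal (\<Phi> (v t)) \<le> real_of_ereal (\<Phi> (v s))"
proof -
  define p q where "p = real_of_ereal (\<Phi> (v s))" and "q = real_of_ereal (\<Phi> (v t))"
  have pq: "\<Phi> (v s) = ereal p" "\<Phi> (v t) = ereal q"
    unfolding p_def q_def using gradient_flow_finite[OF \<Phi> v] st by auto
  have energy: "\<Phi> (v y) - \<Phi> (v x) \<le> - (ereal (1/2) * oriented_integral x y (\<lambda>r. (ennreal (metric_derivative v r))\<^sup>2))
          - ereal (1/2) * oriented_integral x y (\<lambda>r. (g (v r))\<^sup>2)" if "0 < x" "0 < y" for x y
    using v that unfolding gradient_flow_def by blast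
  have forward: "ereal q - ereal p \<le> - (ereal (1/2) * enn2ereal ?A) - ereal (1/2) * enn2ereal ?B"
    using energy[of s t] st unfolding oriented_integral_def pq by simp
  have backward: "ereal p - ereal q \<le> - (ereal (1/2) * - enn2ereal ?A) - ereal (1/2) * - enn2ereal ?B"
    using energy[of t s] st unfolding oriented_integral_def pq by simp
  \<comment> \<open>The energy difference is real, so an infinite integral would put a real number
    below minus infinity.\<close>
  have "?A \<noteq> top" "?B \<noteq> top"
    using forward by (cases ?A; cases ?B; simp add: enn2ereal_ennreal)+
  then obtain x y where xy: "?A = ennreal x" "?B = ennreal y" "0 \<le> x" "0 \<le> y"
    by (cases ?A; cases ?B) auto
  have "2 * (p - q) = x + y"
    using forward backward unfolding xy using xy(3,4) by (simp add: enn2ereal_ennreal)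
  then show "?A + ?B = ennreal (2 * (real_of_ereal (\<Phi> (v s)) - real_of_ereal (\<Phi> (v t))))"
    "real_of_ereal (\<Phi> (v t)) \<le> real_of_ereal (\<Phi> (v s))"
    using xy unfolding p_def[symmetric] q_def[symmetric] by (auto simp: ennreal_plus)
qed

text \<open>By the energy identity the loss over \<open>{t..t+h}\<close> is half the integral of a
  function integrable on \<open>{t..t+1}\<close>, hence small for some \<open>h\<close>;
  monotonicity of the energy extends the bound to all earlier times after \<open>t\<close>.\<close>

lemma gradient_flow_energy_right_continuous:
  fixes \<Phi> :: "'a::metric_space \<Rightarrow> ereal"
  assumes \<Phi>: "\<And>x. \<Phi> x \<noteq> -\<infinity>" and g: "upper_gradient \<Phi> g" and v: "gradient_flow \<Phi> g v"
    and t: "0 < t"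
  shows "((\<lambda>r. \<Phi> (v (t + r))) \<longlongrightarrow> \<Phi> (v t)) (at_right 0)"
proof -
  define \<phi> where "\<phi> r = real_of_ereal (\<Phi> (v r))" for r
  have lac: "loc_abs_continuous v" and dom: "\<forall>t>0. v t \<in> effective_domain \<Phi>"
    using v by (auto simp: gradient_flow_def)
  obtain M where M: "M \<in> borel_measurable borel" "\<And>x. 0 \<le> M x"
    "AE r in lborel. r \<in> {t..t+1} \<longrightarrow> metric_derivative v r = M r"
    by (rule loc_abs_continuous_metric_derivative[OF lac t, of "t+1"]) auto
  \<comment> \<open>\<open>M\<close> and \<open>\<gamma>\<close> are Borel replacements for the
    metric derivative and the slope on the window, so the integral of the sum of squares
    splits.\<close>
  define \<gamma> where "\<gamma> r = g (v r) * indicator {0<..} r" for r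
  note [measurable] = M(1) upper_gradient_measurable[OF g lac dom, folded \<gamma>_def]
  have energy: "(\<integral>\<^sup>+r\<in>{t..t+h}. ((ennreal (M r))\<^sup>2 + (\<gamma> r)\<^sup>2) \<partial>lborel) = ennreal (2 * (\<phi> t - \<phi> (t + h)))"
    if h: "0 < h" "h \<le> 1" for h
  proof -
    have "(\<integral>\<^sup>+r\<in>{t..t+h}. (ennreal (metric_derivative v r))\<^sup>2 \<partial>lborel) = (\<integral>\<^sup>+r\<in>{t..t+h}. (ennreal (M r))\<^sup>2 \<partial>lborel)"
      using M(3) by (intro nn_integral_cong_AE, eventually_elim) (use h in \<open>auto split: split_indicator\<close>)
    moreover have "(\<integral>\<^sup>+r\<in>{t..t+h}. (g (v r))\<^sup>2 \<partial>lborel) = (\<integral>\<^sup>+r\<in>{t..t+h}. (\<gamma> r)\<^sup>2 \<partial>lborel)"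
      using t by (intro nn_integral_cong) (auto simp: \<gamma>_def split: split_indicator)
    ultimately show ?thesis
      using gradient_flow_energy_identity(1)[OF \<Phi> v t, of "t + h"] h
      by (simp add: \<phi>_def distrib_right nn_integral_add)
  qed
  have "(\<phi> \<longlongrightarrow> \<phi> t) (at_right t)"
  proof (rule order_tendstoI)
    fix e assume e: "e < \<phi> t"
    obtain h where h: "0 < h" "h \<le> 1"
      "(\<integral>\<^sup>+r\<in>{t..t+h}. ((ennreal (M r))\<^sup>2 + (\<gamma> r)\<^sup>2) \<partial>lborel) < ennreal (2 * (\<phi> t - e))"
      by (rule ex_small_set_nn_integral[of "\<lambda>r. (ennreal (M r))\<^sup>2 + (\<gamma> r)\<^sup>2" t "ennreal (2 * (\<phi> t - e))"])
        (use energy[of 1] e in auto)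
    then have "\<not> 2 * (\<phi> t - e) \<le> 2 * (\<phi> t - \<phi> (t + h))"
      unfolding energy[OF h(1,2)] using ennreal_leI leD by blast
    then have "e < \<phi> (t + h)" by simp
    have "e < \<phi> r" if "t < r" "r < t + h" for r
      using gradient_flow_energy_identity(2)[OF \<Phi> v, of r "t + h"] that t \<open>e < \<phi> (t + h)\<close>
      by (simp add: \<phi>_def)
    then show "\<forall>\<^sub>F r in at_right t. e < \<phi> r"
      unfolding eventually_at_right_field using h(1) by (intro exI[of _ "t + h"]) auto
  next
    fix e assume e: "\<phi> t < e"
    have "\<phi> r < e" if "t < r" for r
      using gradient_flow_energy_identity(2)[OF \<Phi> v t that] e by (simp add: \<phi>_def)
    then show "\<forall>\<^sub>F r in at_right t. \<phi> r < e"
      by (simp add: eventually_at_filter)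
  qed
  then have "((\<lambda>r. \<phi> (t + r)) \<longlongrightarrow> \<phi> t) (at_right 0)"
    by (simp add: filterlim_at_right_to_0[of \<phi> _ t] add.commute)
  then have "((\<lambda>r. ereal (\<phi> (t + r))) \<longlongrightarrow> ereal (\<phi> t)) (at_right 0)"
    by simp
  moreover have "\<forall>\<^sub>F r in at_right 0. ereal (\<phi> (t + r)) = \<Phi> (v (t + r))"
    unfolding eventually_at_filter \<phi>_def
    using gradient_flow_finite[OF \<Phi> v, of "t + _"] t by (intro always_eventually) auto
  ultimately show ?thesis
    using gradient_flow_finite[OF \<Phi> v t] by (auto simp: \<phi>_def dest: Lim_transform_eventually)
qed

text \<open>The shifted curve \<open>\<lambda>r. v (t + r)\<close> is a flow that issues from
  \<open>v t\<close>; right continuity of the energy supplies the convergence at time zero.\<close>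

lemma gradient_flow_in_flow_starting_points:
  fixes \<Phi> :: "'a::metric_space \<Rightarrow> ereal"
  assumes \<Phi>: "\<And>x. \<Phi> x \<noteq> -\<infinity>" and g: "upper_gradient \<Phi> g" and v: "gradient_flow \<Phi> g v"
    and t: "0 < t"
  shows "v t \<in> flow_starting_points \<Phi> g"
  unfolding flow_starting_points_def
proof (intro CollectI conjI exI[of _ "\<lambda>r. v (t + r)"])
  show "v t \<in> effective_domain \<Phi>" using v t by (auto simp: gradient_flow_def)
  show "gradient_flow \<Phi> g (\<lambda>r. v (t + r))" by (rule gradient_flow_translate[OF v t])
  show "((\<lambda>r. \<Phi> (v (t + r))) \<longlongrightarrow> \<Phi> (v t)) (at_right 0)"
    by (rule gradient_flow_energy_right_continuous[OF \<Phi> g v t])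
  have "isCont v t" using v t loc_abs_continuous_imp_isCont by (auto simp: gradient_flow_def)
  then have "((\<lambda>r. v (t + r)) \<longlongrightarrow> v t) (at 0)" by (simp add: isCont_iff)
  then show "((\<lambda>r. v (t + r)) \<longlongrightarrow> v t) (at_right 0)"
    by (rule tendsto_within_subset) simp
qed

text \<open>The bound \<open>2 c x \<le> x\<^sup>2 + c\<^sup>2\<close>; the second summand on the left measures by how much
  the slope exceeds \<open>c\<close> and makes the final inequality strict.\<close>
lemma gradient_flow_descent:
  fixes \<Phi> :: "'a::metric_space \<Rightarrow> ereal" and c :: real
  assumes \<Phi>: "\<And>x. \<Phi> x \<noteq> -\<infinity>" and g: "upper_gradient \<Phi> g" and v: "gradient_flow \<Phi> g v"
    and st: "0 < s" "s < t" and c: "0 \<le> c" and gc: "\<And>r. r \<in> {s..t} \<Longrightarrow> ennreal c \<le> g (v r)"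
  shows "ennreal (2 * c * dist (v t) (v s)) + (\<integral>\<^sup>+r\<in>{s..t}. ((g (v r))\<^sup>2 - ennreal (c\<^sup>2)) \<partial>lborel)
      \<le> ennreal (2 * (real_of_ereal (\<Phi> (v s)) - real_of_ereal (\<Phi> (v t))))"
proof -
  have lac: "loc_abs_continuous v" and dom: "\<forall>t>0. v t \<in> effective_domain \<Phi>"
    using v by (auto simp: gradient_flow_def)
  obtain M where M: "M \<in> borel_measurable borel" "\<And>x. 0 \<le> M x"
    "AE r in lborel. r \<in> {s..t} \<longrightarrow> metric_derivative v r = M r"
    "ennreal (dist (v t) (v s)) \<le> (\<integral>\<^sup>+r\<in>{s..t}. ennreal (M r) \<partial>lborel)"
    by (rule loc_abs_continuous_metric_derivative[OF lac st]) (use st in auto)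
  define \<gamma> where "\<gamma> r = g (v r) * indicator {0<..} r" for r
  note [measurable] = M(1) upper_gradient_measurable[OF g lac dom, folded \<gamma>_def]
  have \<gamma>: "g (v r) = \<gamma> r" if "r \<in> {s..t}" for r
    using that st by (auto simp: \<gamma>_def)
  \<comment> \<open>For finite \<open>y\<close> the truncated subtraction is genuine because
    \<open>c\<close> does not exceed \<open>y\<close>, and the claim reduces to
    \<open>0 \<le> (x - c)\<^sup>2\<close>. For infinite \<open>y\<close> the right-hand side is
    infinite.\<close>
  have pointwise: "ennreal (2 * c * x) + (y\<^sup>2 - ennreal (c\<^sup>2)) \<le> (ennreal x)\<^sup>2 + y\<^sup>2"
    if "0 \<le> x" "ennreal c \<le> y" for x and y :: ennreal
  proof (cases y)
    case (real z)
    then have z: "c \<le> z" "c\<^sup>2 \<le> z\<^sup>2" using that c by (auto intro: power_mono)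
    have "0 \<le> (x - c)\<^sup>2" by simp
    then have "2 * c * x + (z\<^sup>2 - c\<^sup>2) \<le> x\<^sup>2 + z\<^sup>2"
      by (simp add: power2_eq_square algebra_simps)
    then have "ennreal (2 * c * x + (z\<^sup>2 - c\<^sup>2)) \<le> ennreal (x\<^sup>2 + z\<^sup>2)"
      by (rule ennreal_leI)
    then show ?thesis
      using real z that c by (simp add: ennreal_power ennreal_minus ennreal_plus)
  qed (simp add: power2_eq_square)
  have "ennreal (2 * c * dist (v t) (v s)) = ennreal (2 * c) * ennreal (dist (v t) (v s))"
    using c by (intro ennreal_mult) auto
  also have "\<dots> \<le> ennreal (2 * c) * (\<integral>\<^sup>+r\<in>{s..t}. ennreal (M r) \<partial>lborel)"
    using M(4) by (rule mult_left_mono) simp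
  also have "\<dots> = (\<integral>\<^sup>+r. ennreal (2 * c) * (ennreal (M r) * indicator {s..t} r) \<partial>lborel)"
    by (rule nn_integral_cmult[symmetric]) measurable
  also have "\<dots> = (\<integral>\<^sup>+r\<in>{s..t}. ennreal (2 * c * M r) \<partial>lborel)"
    using c M(2) by (intro nn_integral_cong) (auto simp: ennreal_mult split: split_indicator)
  finally have "ennreal (2 * c * dist (v t) (v s)) + (\<integral>\<^sup>+r\<in>{s..t}. ((g (v r))\<^sup>2 - ennreal (c\<^sup>2)) \<partial>lborel)
      \<le> (\<integral>\<^sup>+r\<in>{s..t}. ennreal (2 * c * M r) \<partial>lborel) + (\<integral>\<^sup>+r\<in>{s..t}. ((\<gamma> r)\<^sup>2 - ennreal (c\<^sup>2)) \<partial>lborel)"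
    by (intro add_mono) (auto intro!: nn_integral_mono simp: \<gamma> split: split_indicator)
  also have "\<dots> = (\<integral>\<^sup>+r. ennreal (2 * c * M r) * indicator {s..t} r + ((\<gamma> r)\<^sup>2 - ennreal (c\<^sup>2)) * indicator {s..t} r \<partial>lborel)"
    by (rule nn_integral_add[symmetric]) measurable
  also have "\<dots> \<le> (\<integral>\<^sup>+r. (ennreal (M r))\<^sup>2 * indicator {s..t} r + (\<gamma> r)\<^sup>2 * indicator {s..t} r \<partial>lborel)"
    using pointwise[OF M(2)] gc by (intro nn_integral_mono) (auto simp: \<gamma> split: split_indicator)
  also have "\<dots> = (\<integral>\<^sup>+r\<in>{s..t}. (ennreal (M r))\<^sup>2 \<partial>lborel) + (\<integral>\<^sup>+r\<in>{s..t}. (\<gamma> r)\<^sup>2 \<partial>lborel)"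
    by (rule nn_integral_add) measurable
  also have "(\<integral>\<^sup>+r\<in>{s..t}. (ennreal (M r))\<^sup>2 \<partial>lborel) = (\<integral>\<^sup>+r\<in>{s..t}. (ennreal (metric_derivative v r))\<^sup>2 \<partial>lborel)"
    using M(3) by (intro nn_integral_cong_AE, eventually_elim) (auto split: split_indicator)
  also have "(\<integral>\<^sup>+r\<in>{s..t}. (\<gamma> r)\<^sup>2 \<partial>lborel) = (\<integral>\<^sup>+r\<in>{s..t}. (g (v r))\<^sup>2 \<partial>lborel)"
    by (intro nn_integral_cong) (auto simp: \<gamma> split: split_indicator)
  finally show ?thesis
    unfolding gradient_flow_energy_identity(1)[OF \<Phi> v st] .
qed

theorem theorem2p3:
  fixes \<Phi> :: "'a::metric_space \<Rightarrow> ereal"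
    and g :: "'a \<Rightarrow> ennreal"
    and u :: 'a
    and \<epsilon> lam :: real
  assumes "\<And>x. \<Phi> x \<noteq> -\<infinity>"
    and "proper_functional \<Phi>"
    and "\<exists>c::real. \<forall>x. ereal c \<le> \<Phi> x"
    and "upper_gradient \<Phi> g"
    and "flow_starting_points \<Phi> g \<noteq> {}"
    and "u \<in> flow_starting_points \<Phi> g"
    and "\<epsilon> > 0"
    and "\<Phi> u \<le> (INF x. \<Phi> x) + ereal \<epsilon>"
    and "lam > 0"
  shows "\<exists>u' \<in> flow_starting_points \<Phi> g.
           dist u u' \<le> lam \<and> \<Phi> u' \<le> \<Phi> u \<and> g u' \<le> ennreal (\<epsilon> / lam)"
proof -
  note \<Phi> = assms(1) and g = assms(4)
  define c where "c = \<epsilon> / lam"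
  have c: "c > 0" "c * lam = \<epsilon>" using \<open>\<epsilon> > 0\<close> \<open>lam > 0\<close> by (auto simp: c_def)
  obtain v where v: "gradient_flow \<Phi> g v" and vu: "(v \<longlongrightarrow> u) (at_right 0)"
    and \<Phi>vu: "((\<lambda>t. \<Phi> (v t)) \<longlongrightarrow> \<Phi> u) (at_right 0)" and udom: "\<Phi> u < \<infinity>"
    using assms(6) by (auto simp: flow_starting_points_def effective_domain_def)
  define \<phi> where "\<phi> r = real_of_ereal (\<Phi> (v r))" for r
  define \<phi>u where "\<phi>u = real_of_ereal (\<Phi> u)"
  have \<Phi>u: "\<Phi> u = ereal \<phi>u"
    using \<Phi>[of u] udom by (cases "\<Phi> u") (auto simp: \<phi>u_def)
  have \<Phi>v: "\<Phi> (v t) = ereal (\<phi> t)" if "0 < t" for t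
    using gradient_flow_finite[OF \<Phi> v that] by (simp add: \<phi>_def)
  have "((\<lambda>t. ereal (\<phi> t)) \<longlongrightarrow> ereal \<phi>u) (at_right 0)"
    using \<Phi>vu unfolding \<Phi>u
    by (rule Lim_transform_eventually) (auto simp: eventually_at_filter \<Phi>v)
  then have \<phi>u: "(\<phi> \<longlongrightarrow> \<phi>u) (at_right 0)" by simp
  have anti: "\<phi> t \<le> \<phi> s" if "0 < s" "s < t" for s t
    using gradient_flow_energy_identity(2)[OF \<Phi> v that] by (simp add: \<phi>_def)
  have le_u: "\<phi> t \<le> \<phi>u" if "0 < t" for t
  proof (rule tendsto_lowerbound[OF \<phi>u])
    show "\<forall>\<^sub>F s in at_right 0. \<phi> t \<le> \<phi> s"
      unfolding eventually_at_right_field using that anti by (intro exI[of _ t]) auto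
  qed simp
  have ge_u: "\<phi>u - \<epsilon> \<le> \<phi> t" if "0 < t" for t
  proof -
    have "\<Phi> u \<le> \<Phi> (v t) + ereal \<epsilon>"
      using assms(8) by (rule order_trans) (intro add_right_mono INF_lower UNIV_I)
    then show ?thesis using \<Phi>v[OF that] by (simp add: \<Phi>u)
  qed
  have "\<exists>t>0. dist u (v t) \<le> lam \<and> g (v t) \<le> ennreal c"
  proof (rule ccontr)
    assume "\<not> ?thesis"
    then have big: "ennreal c < g (v t)" if "0 < t" "dist u (v t) \<le> lam" for t
      using that by (auto simp: not_le)
    have cont: "isCont v t" if "0 < t" for t
      using v that loc_abs_continuous_imp_isCont by (auto simp: gradient_flow_def)
    show False
    proof (cases "\<forall>t>0. dist u (v t) \<le> lam")
      case True
      \<comment> \<open>With this choice \<open>c\<^sup>2 * (t - 1)\<close> is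
        \<open>c\<^sup>2 + 2 * \<epsilon>\<close>. The integral starts at 1 because the energy
        identity concerns positive times.\<close>
      define t where "t = 2 + 2 * \<epsilon> / c\<^sup>2"
      have t: "1 < t" "c\<^sup>2 * (t - 1) > 2 * \<epsilon>"
        using c \<open>\<epsilon> > 0\<close> by (auto simp: t_def field_simps add_strict_increasing)
      have "ennreal (c\<^sup>2 * (t - 1)) = (\<integral>\<^sup>+r\<in>{1..t}. ennreal (c\<^sup>2) \<partial>lborel)"
        using t by (simp add: nn_integral_cmult_indicator ennreal_mult)
      also have "\<dots> \<le> (\<integral>\<^sup>+r\<in>{1..t}. (g (v r))\<^sup>2 \<partial>lborel)"
      proof (rule nn_integral_mono)
        fix r
        show "ennreal (c\<^sup>2) * indicator {1..t} r \<le> (g (v r))\<^sup>2 * indicator {1..t} r"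
          using big[of r] True c power_mono[of "ennreal c" "g (v r)" 2]
          by (auto simp: ennreal_power split: split_indicator)
      qed
      also have "\<dots> \<le> ennreal (2 * (\<phi> 1 - \<phi> t))"
        unfolding \<phi>_def gradient_flow_energy_identity(1)[OF \<Phi> v zero_less_one t(1), symmetric] by simp
      finally have "c\<^sup>2 * (t - 1) \<le> 2 * (\<phi> 1 - \<phi> t)"
        using anti[OF zero_less_one t(1)] by (simp add: ennreal_le_iff)
      then show False using t le_u[of 1] ge_u[of t] by simp
    next
      case False
      then obtain t0 where t0: "0 < t0" "lam < dist u (v t0)" by (auto simp: not_le)
      have "\<forall>\<^sub>F t in at_right 0. dist (v t) u < lam"
        using vu \<open>lam > 0\<close> by (rule tendstoD)
      then obtain \<delta> where \<delta>: "\<delta> > 0" "\<And>t. 0 < t \<Longrightarrow> t < \<delta> \<Longrightarrow> dist u (v t) < lam"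
        unfolding eventually_at_right_field by (auto simp: dist_commute)
      \<comment> \<open>Before \<open>\<delta>\<close> the curve lies strictly inside the ball.
        Searching for the exit time from \<open>a > 0\<close> onwards stays within the times where
        \<open>v\<close> is continuous.\<close>
      define a where "a = \<delta> / 2"
      have a: "0 < a" "a < \<delta>" using \<delta> by (auto simp: a_def)
      have "a \<le> t0" using \<delta>(2)[of t0] t0 a by (cases "t0 < \<delta>") auto
      have contd: "continuous_on {a..t0} (\<lambda>t. dist u (v t))"
        using cont a by (intro continuous_intros continuous_at_imp_continuous_on) auto
      obtain T where T: "a \<le> T" "T \<le> t0" "dist u (v T) = lam"
        and first: "\<And>r. a \<le> r \<Longrightarrow> r < T \<Longrightarrow> dist u (v r) < lam"
      proof -
        \<comment> \<open>The first time in \<open>S\<close> is the exit time. The intermediate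
          value theorem gives a time at distance exactly \<open>lam\<close> no later than it; that
          time lies in \<open>S\<close>, so the two coincide.\<close>
        define S where "S = {t \<in> {a..t0}. lam \<le> dist u (v t)}"
        have "closed S"
          unfolding S_def by (intro continuous_on_closed_Collect_le contd continuous_on_const) auto
        then have "compact ({a..t0} \<inter> S)" by (rule compact_Int_closed[OF compact_Icc])
        moreover have "{a..t0} \<inter> S = S" by (auto simp: S_def)
        ultimately have "compact S" by simp
        moreover have "t0 \<in> S" using t0 \<open>a \<le> t0\<close> by (simp add: S_def)
        ultimately obtain T where T: "T \<in> S" "\<And>t. t \<in> S \<Longrightarrow> T \<le> t"
          using compact_attains_inf[of S] by auto
        then have aT: "a \<le> T" "T \<le> t0" by (auto simp: S_def)
        have "\<exists>x. a \<le> x \<and> x \<le> T \<and> dist u (v x) = lam"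
          using \<delta>(2)[of a] a T aT
          by (intro IVT' continuous_on_subset[OF contd]) (auto simp: S_def)
        then obtain x where x: "a \<le> x" "x \<le> T" "dist u (v x) = lam" by blast
        then have "T \<le> x" using aT by (intro T(2)) (simp add: S_def)
        then show ?thesis
          using that[of T] x aT T(2) by (force simp: S_def)
      qed
      have near: "dist u (v r) \<le> lam" if "0 < r" "r \<le> T" for r
        using \<delta>(2)[OF that(1)] first[of r] that a T by (cases "r < a"; cases "r = T") force+
      have gc: "ennreal c < g (v r)" if "0 < r" "r \<le> T" for r
        using big near that by simp
      have "0 < T" using a T by simp
      \<comment> \<open>\<open>D\<close> is the slack that makes the contradiction strict. It is
        taken over a fixed interval, independent of the starting time \<open>s\<close>, so that it
        survives the limit of \<open>s\<close> to 0. It is nonzero because its integrand is positive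
        on an interval of positive length.\<close>
      define D where "D = (\<integral>\<^sup>+r\<in>{T/2..T}. ((g (v r))\<^sup>2 - ennreal (c\<^sup>2)) \<partial>lborel)"
      have "D \<noteq> 0"
      proof
        assume "D = 0"
        define \<gamma> where "\<gamma> r = g (v r) * indicator {0<..} r" for r
        have [measurable]: "\<gamma> \<in> borel_measurable borel"
          unfolding \<gamma>_def using upper_gradient_measurable[OF g] v by (auto simp: gradient_flow_def)
        have "D = (\<integral>\<^sup>+r\<in>{T/2..T}. ((\<gamma> r)\<^sup>2 - ennreal (c\<^sup>2)) \<partial>lborel)"
          unfolding D_def using \<open>0 < T\<close> by (intro nn_integral_cong) (auto simp: \<gamma>_def split: split_indicator)
        with \<open>D = 0\<close> have "(\<integral>\<^sup>+r\<in>{T/2..T}. ((\<gamma> r)\<^sup>2 - ennreal (c\<^sup>2)) \<partial>lborel) = 0" by simp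
        then have "AE r in lborel. ((\<gamma> r)\<^sup>2 - ennreal (c\<^sup>2)) * indicator {T/2..T} r = 0"
          by (rule nn_integral_0_iff_AE[THEN iffD1, rotated]) measurable
        then have "AE r in lborel. r \<notin> {T/2..T}"
        proof eventually_elim
          case (elim r)
          show ?case
          proof
            assume r: "r \<in> {T/2..T}"
            with elim \<open>0 < T\<close> have "(g (v r))\<^sup>2 - ennreal (c\<^sup>2) = 0" by (simp add: \<gamma>_def)
            then have "(g (v r))\<^sup>2 \<le> (ennreal c)\<^sup>2"
              using c by (simp add: ennreal_power ennreal_minus_eq_0)
            then have "g (v r) \<le> ennreal c"
              using c by (cases "g (v r)") (auto simp: ennreal_power top_unique dest: power2_le_imp_le)
            moreover have "0 < r" "r \<le> T" using r \<open>0 < T\<close> by auto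
            ultimately show False using gc leD by blast
          qed
        qed
        then have "{T/2..T} \<in> null_sets lborel"
          using AE_iff_null_sets[of "{T/2..T}" lborel] by simp
        then show False using \<open>0 < T\<close> by (simp add: null_sets_def)
      qed
      have descent: "ennreal (2 * c * dist (v T) (v s)) + D \<le> ennreal (2 * (\<phi> s - \<phi> T))"
        if s: "0 < s" "s < T/2" for s
      proof -
        have "D \<le> (\<integral>\<^sup>+r\<in>{s..T}. ((g (v r))\<^sup>2 - ennreal (c\<^sup>2)) \<partial>lborel)"
          unfolding D_def using s by (intro nn_set_integral_set_mono) auto
        moreover have "ennreal (2 * c * dist (v T) (v s)) + (\<integral>\<^sup>+r\<in>{s..T}. ((g (v r))\<^sup>2 - ennreal (c\<^sup>2)) \<partial>lborel)
           \<le> ennreal (2 * (\<phi> s - \<phi> T))"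
          unfolding \<phi>_def
          using s c gc by (intro gradient_flow_descent[OF \<Phi> g v]) (auto intro: less_imp_le)
        ultimately show ?thesis by (meson add_left_mono order_trans)
      qed
      \<comment> \<open>Any time below \<open>T/2\<close> would do here: the descent estimate bounds
        \<open>D\<close> by a real number.\<close>
      have "D \<noteq> \<infinity>"
        using descent[of "T/4"] \<open>0 < T\<close> by (auto simp: top_unique)
      then obtain d where d: "D = ennreal d" "0 < d"
        using \<open>D \<noteq> 0\<close> by (cases D) (auto simp: less_le)
      have descent': "2 * c * dist (v T) (v s) + d \<le> 2 * (\<phi> s - \<phi> T)"
        if s: "0 < s" "s < T/2" for s
        using descent[OF s] anti[of s T] s c d
        by (simp add: ennreal_plus[symmetric] del: ennreal_plus)
      \<comment> \<open>The flow has no prescribed value at time 0, so the estimate is passed to the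
        limit through the convergence of \<open>v\<close> and of the energy. With distance
        \<open>lam\<close> and \<open>c * lam = \<epsilon>\<close>, the left-hand side becomes
        \<open>2 * \<epsilon> + d\<close>, while the energy drop on the right is at most
        \<open>2 * \<epsilon>\<close>.\<close>
      have "2 * c * dist (v T) u + d \<le> 2 * (\<phi>u - \<phi> T)"
      proof (rule tendsto_le)
        show "((\<lambda>s. 2 * (\<phi> s - \<phi> T)) \<longlongrightarrow> 2 * (\<phi>u - \<phi> T)) (at_right 0)"
          by (intro tendsto_intros \<phi>u)
        show "((\<lambda>s. 2 * c * dist (v T) (v s) + d) \<longlongrightarrow> 2 * c * dist (v T) u + d) (at_right 0)"
          by (intro tendsto_intros vu)
        show "\<forall>\<^sub>F s in at_right 0. 2 * c * dist (v T) (v s) + d \<le> 2 * (\<phi> s - \<phi> T)"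
          unfolding eventually_at_right_field using \<open>0 < T\<close> descent' by (intro exI[of _ "T/2"]) auto
      qed simp
      then show False
        using T(3) ge_u[OF \<open>0 < T\<close>] d(2) c(2) by (simp add: dist_commute)
    qed
  qed
  then obtain t where t: "0 < t" "dist u (v t) \<le> lam" "g (v t) \<le> ennreal c" by blast
  then show ?thesis
    using gradient_flow_in_flow_starting_points[OF \<Phi> g v t(1)] le_u[OF t(1)]
    by (intro bexI[of _ "v t"]) (auto simp: \<Phi>u \<Phi>v c_def)
qed

end
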